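(* Let $\mathcal{G}=(V,E)$ be a connected, undirected and unweighted finite graph, and let $\mathbf{H}=(H(i,j))_{i,j\in V}$ be a positive definite graph filter on $\mathcal{G}$ with geodesic-width $\omega(\mathbf{H})$. Let $\mathbf{P}_{\mathbf{H}}^{\rm sym}$ be the diagonal matrix with diagonal entries $$P_{\mathbf{H}}^{\rm sym}(i,i)=\sum_{j\in B(i,\omega(\mathbf{H}))}|H(i,j)|,\quad i\in V.$$ Let $\mathbf{y}\in\mathbb{R}^V$, let $\mathbf{x}^{(0)}\in\mathbb{R}^V$ be an arbitrary initial vector, and define $\mathbf{x}^{(m)}$, $m\ge 1$, iteratively by $$\mathbf{x}^{(m)}=\mathbf{x}^{(m-1)}-(\mathbf{P}_{\mathbf{H}}^{\rm sym})^{-1}(\mathbf{H}\mathbf{x}^{(m-1)}-\mathbf{y}),\quad m\ge 1.$$ Then $\mathbf{x}^{(m)}$, $m\ge 0$, converges exponentially (to $\mathbf{H}^{-1}\mathbf{y}$), and for all $m\ge 0$, $$\|(\mathbf{P}_{\mathbf{H}}^{\rm sym})^{1/2}(\mathbf{x}^{(m)}-\mathbf{H}^{-1}\mathbf{y})\|_2\le \big(r(\mathbf{I}-(\mathbf{P}_{\mathbf{H}}^{\rm sym})^{-1}\mathbf{H})\big)^m\,\big\|(\mathbf{P}_{\mathbf{H}}^{\rm sym})^{1/2}(\mathbf{x}^{(0)}-\mathbf{H}^{-1}\mathbf{y})\big\|_2.$$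
   Context: For a connected, undirected and unweighted finite graph $\mathcal{G}=(V,E)$, the geodesic distance $\rho(i,j)$ between $i,j\in V$ is the number of edges in a shortest path connecting $i$ and $j$, and $B(i,s)=\{j\in V:\ \rho(j,i)\le s\}$, $s\ge 0$, is the set of all $s$-hop neighbors of $i$ (including $i$ itself). A graph filter is a real matrix $\mathbf{H}=(H(i,j))_{i,j\in V}$ indexed by the vertices. It has geodesic-width $\omega(\mathbf{H})$ (a nonnegative integer) if $H(i,j)=0$ for all $i,j\in V$ with $\rho(i,j)>\omega(\mathbf{H})$. Positive definite includes symmetric. $r(\mathbf{A})$ denotes the spectral radius of a matrix $\mathbf{A}$, $\mathbf{I}$ the identity matrix, and $\|\mathbf{x}\|_2=(\sum_{j\in V}|x(j)|^2)^{1/2}$ for $\mathbf{x}=(x(j))_{j\in V}$. A sequence $\mathbf{x}^{(m)}$ converges exponentially to $\mathbf{x}$ if there exist $C>0$ and $q\in[0,1)$ with $\|\mathbf{x}^{(m)}-\mathbf{x}\|_2\le Cq^m$ for all $m\ge 0$. *)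

theory Defs
  imports
    "HOL-Analysis.Analysis"
    "Graph_Theory.Arc_Walk"
    "Graph_Theory.Digraph_Component"
begin

text \<open>
  A finite undirected graph is a symmetric digraph (\<open>graph\<close> of \<open>Graph_Theory\<close>): each edge is a
  pair of opposite arcs, so the number of arcs of a path is the number of its edges.
\<close>

definition geodesic_dist :: "('v, 'e) pre_digraph \<Rightarrow> 'v \<Rightarrow> 'v \<Rightarrow> nat" where
  "geodesic_dist G i j = (LEAST n. \<exists>p. pre_digraph.apath G i p j \<and> length p = n)"

definition hop_ball :: "('v, 'e) pre_digraph \<Rightarrow> 'v \<Rightarrow> nat \<Rightarrow> 'v set" where
  "hop_ball G i s = {j \<in> verts G. geodesic_dist G j i \<le> s}"

definition has_geodesic_width ::
    "('v::finite, 'e) pre_digraph \<Rightarrow> real^'v^'v \<Rightarrow> nat \<Rightarrow> bool" where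
  "has_geodesic_width G H w \<longleftrightarrow>
     (\<forall>i\<in>verts G. \<forall>j\<in>verts G. geodesic_dist G i j > w \<longrightarrow> H $ i $ j = 0)"

definition positive_definite :: "real^'n^'n \<Rightarrow> bool" where
  "positive_definite A \<longleftrightarrow> transpose A = A \<and> (\<forall>x. x \<noteq> 0 \<longrightarrow> 0 < x \<bullet> (A *v x))"

definition positive_semidefinite :: "real^'n^'n \<Rightarrow> bool" where
  "positive_semidefinite A \<longleftrightarrow> transpose A = A \<and> (\<forall>x. 0 \<le> x \<bullet> (A *v x))"

definition mat_sqrt :: "real^'n^'n \<Rightarrow> real^'n^'n" where
  "mat_sqrt A = (THE S. positive_semidefinite S \<and> S ** S = A)"

definition diagonal_matrix :: "('n \<Rightarrow> real) \<Rightarrow> real^'n^'n" where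
  "diagonal_matrix d = (\<chi> i j. if i = j then d i else 0)"

definition complex_eigenvalues :: "real^'n^'n \<Rightarrow> complex set" where
  "complex_eigenvalues A =
     {c. \<exists>v::complex^'n. v \<noteq> 0 \<and> (\<chi> i j. complex_of_real (A $ i $ j)) *v v = c *s v}"

text \<open>The set of eigenvalues is finite and nonempty, so the supremum is a maximum.\<close>

definition spectral_radius :: "real^'n^'n \<Rightarrow> real" where
  "spectral_radius A = (SUP c\<in>complex_eigenvalues A. cmod c)"

definition P_sym :: "('v::finite, 'e) pre_digraph \<Rightarrow> nat \<Rightarrow> real^'v^'v \<Rightarrow> real^'v^'v" where
  "P_sym G w H = diagonal_matrix (\<lambda>i. \<Sum>j\<in>hop_ball G i w. \<bar>H $ i $ j\<bar>)"

definition converges_exponentially :: "(nat \<Rightarrow> 'a::real_normed_vector) \<Rightarrow> 'a \<Rightarrow> bool" where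
  "converges_exponentially x l \<longleftrightarrow>
     (\<exists>C q. C > 0 \<and> 0 \<le> q \<and> q < 1 \<and> (\<forall>m. norm (x m - l) \<le> C * q ^ m))"

lemma positive_definite_invertible:
  assumes "positive_definite A"
  shows "invertible A"
proof -
  have "x = 0" if "A *v x = 0" for x
    using assms that unfolding positive_definite_def by (metis inner_zero_right less_irrefl)
  then show ?thesis
    using invertible_left_inverse matrix_left_invertible_ker by blast
qed

lemma diagonal_matrix_vector: "diagonal_matrix d *v x = (\<chi> i. d i * x $ i)"
  by (simp add: diagonal_matrix_def matrix_vector_mult_def vec_eq_iff if_distrib
      [of "\<lambda>c. c * _"] cong: if_cong)

lemma diagonal_matrix_mult_left: "diagonal_matrix d ** A = (\<chi> i j. d i * A $ i $ j)"
  by (simp add: diagonal_matrix_def matrix_matrix_mult_def vec_eq_iff if_distrib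
      [of "\<lambda>c. c * _"] cong: if_cong)

lemma diagonal_matrix_mult_right: "A ** diagonal_matrix d = (\<chi> i j. A $ i $ j * d j)"
  by (simp add: diagonal_matrix_def matrix_matrix_mult_def vec_eq_iff if_distrib cong: if_cong)

text \<open>On diagonal matrices with positive entries, the square root is the entrywise one.\<close>

lemma mat_sqrt_diagonal_matrix:
  fixes d :: "'n::finite \<Rightarrow> real"
  assumes d: "\<And>i. 0 < d i"
  shows "mat_sqrt (diagonal_matrix d) = diagonal_matrix (\<lambda>i. sqrt (d i))"
  unfolding mat_sqrt_def
proof (rule the_equality)
  let ?D = "diagonal_matrix d" and ?T = "diagonal_matrix (\<lambda>i. sqrt (d i))"
  have TT: "?T ** ?T = ?D"
    unfolding diagonal_matrix_mult_left using d
    by (simp add: diagonal_matrix_def vec_eq_iff less_imp_le)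
  have Tinner: "x \<bullet> (?T *v x) = (\<Sum>i\<in>UNIV. sqrt (d i) * (x $ i)\<^sup>2)" for x
    by (simp add: diagonal_matrix_vector inner_vec_def power2_eq_square mult.left_commute)
  have Tsym: "transpose ?T = ?T"
    by (auto simp: transpose_def diagonal_matrix_def vec_eq_iff)
  have Tpd: "0 < x \<bullet> (?T *v x)" if x: "x \<noteq> 0" for x
  proof -
    obtain k where "x $ k \<noteq> 0" using x by (auto simp: vec_eq_iff)
    then show ?thesis unfolding Tinner using d
      by (intro sum_pos2[of _ k]) (auto simp: less_imp_le)
  qed
  have "0 \<le> x \<bullet> (?T *v x)" for x
    unfolding Tinner using d by (intro sum_nonneg) (auto simp: less_imp_le)
  then show "positive_semidefinite ?T \<and> ?T ** ?T = ?D"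
    using Tsym TT by (simp add: positive_semidefinite_def)
  fix S assume S: "positive_semidefinite S \<and> S ** S = ?D"
  have "S ** ?D = ?D ** S"
    using S by (metis matrix_mul_assoc)
  then have "S $ i $ j * d j = d i * S $ i $ j" for i j
    by (simp add: diagonal_matrix_mult_left diagonal_matrix_mult_right vec_eq_iff)
  then have comm: "S ** ?T = ?T ** S"
    by (auto simp: diagonal_matrix_mult_left diagonal_matrix_mult_right vec_eq_iff)
  have "(S + ?T) ** (S - ?T) = S ** S - S ** ?T + (?T ** S - ?T ** ?T)"
    by (simp add: matrix_matrix_mult_def vec_eq_iff algebra_simps sum.distrib sum_subtractf)
  then have prod0: "(S + ?T) ** (S - ?T) = 0"
    using S TT comm by simp
  have ker: "x = 0" if "(S + ?T) *v x = 0" for x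
  proof (rule ccontr)
    assume "x \<noteq> 0"
    then have "0 < x \<bullet> (S *v x) + x \<bullet> (?T *v x)"
      using S Tpd[of x] by (simp add: positive_semidefinite_def add_nonneg_pos)
    also have "\<dots> = x \<bullet> ((S + ?T) *v x)"
      by (simp add: matrix_vector_mult_add_rdistrib inner_add_right)
    finally show False using that by simp
  qed
  have "(S - ?T) *v x = 0" for x
    using ker[of "(S - ?T) *v x"] prod0 by (simp add: matrix_vector_mul_assoc)
  then have "S - ?T = 0"
    by (metis matrix_eq matrix_vector_mult_0)
  then show "S = ?T" by simp
qed

end

(*
  Because H is symmetric of geodesic-width \<omega>, P = P_sym carries the full absolute row sums of H.
  With E = P^(-1/2), the iteration matrix 1 - P^(-1) H is similar to the symmetric matrix
  B = 1 - E H E, so x^(m) - H^(-1) y, rescaled by P^(1/2), evolves by B.  The operator norm of a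
  symmetric matrix is the modulus of one of its eigenvalues, so it is at most the spectral radius.
  Positive definiteness of H and the weighted AM-GM bound x.Hx <= x.Px put the eigenvalues of B
  into [0,1).
*)
theory Submission
  imports Defs
begin

text \<open>\<open>matrix_inv\<close> is a Hilbert choice among two-sided inverses. Any such choice
  C equals B, because C = C A B = B.\<close>

lemma matrix_inv_unique:
  fixes A :: "'a::semiring_1^'n^'m"
  assumes AB: "A ** B = mat 1" and BA: "B ** A = mat 1"
  shows "matrix_inv A = B"
  unfolding matrix_inv_def
proof (rule some_equality)
  fix C assume "A ** C = mat 1 \<and> C ** A = mat 1"
  then show "C = B"
    by (metis AB matrix_mul_assoc matrix_mul_lid matrix_mul_rid)
qed (use AB BA in simp)

text \<open>Serves only to bound the supremum in \<open>spectral_radius\<close> from above. Read the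
  eigenvalue equation in the row k where the eigenvector has its largest modulus; summing over all
  rows then removes the dependence on k.\<close>

lemma complex_eigenvalues_bounded:
  fixes A :: "real^'n^'n"
  assumes c: "c \<in> complex_eigenvalues A"
  shows "cmod c \<le> (\<Sum>i\<in>UNIV. \<Sum>j\<in>UNIV. \<bar>A $ i $ j\<bar>)"
proof -
  obtain v :: "complex^'n" where v: "v \<noteq> 0"
    and ev: "(\<chi> i j. complex_of_real (A $ i $ j)) *v v = c *s v"
    using c by (auto simp: complex_eigenvalues_def)
  have "finite (range (\<lambda>i. cmod (v $ i)))" by simp
  then have "Max (range (\<lambda>i. cmod (v $ i))) \<in> range (\<lambda>i. cmod (v $ i))"
    by (intro Max_in) auto
  then obtain k where "Max (range (\<lambda>i. cmod (v $ i))) = cmod (v $ k)" by (rule rangeE)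
  then have k: "cmod (v $ i) \<le> cmod (v $ k)" for i
    by (metis Max_ge \<open>finite (range (\<lambda>i. cmod (v $ i)))\<close> rangeI)
  have kpos: "cmod (v $ k) > 0"
  proof (rule ccontr)
    assume "\<not> cmod (v $ k) > 0"
    then have "cmod (v $ i) \<le> 0" for i using k[of i] by linarith
    then show False using v by (simp add: vec_eq_iff)
  qed
  have "c * v $ k = (\<Sum>j\<in>UNIV. complex_of_real (A $ k $ j) * v $ j)"
    using arg_cong[OF ev, of "\<lambda>w. w $ k"] by (simp add: matrix_vector_mult_def)
  then have "cmod c * cmod (v $ k) \<le> (\<Sum>j\<in>UNIV. \<bar>A $ k $ j\<bar> * cmod (v $ j))"
    by (metis (no_types, lifting) norm_mult norm_of_real norm_sum sum.cong)
  also have "\<dots> \<le> (\<Sum>j\<in>UNIV. \<bar>A $ k $ j\<bar>) * cmod (v $ k)"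
    unfolding sum_distrib_right by (intro sum_mono mult_left_mono k) auto
  finally have "cmod c \<le> (\<Sum>j\<in>UNIV. \<bar>A $ k $ j\<bar>)"
    using kpos by simp
  also have "\<dots> \<le> (\<Sum>i\<in>UNIV. \<Sum>j\<in>UNIV. \<bar>A $ i $ j\<bar>)"
    by (rule member_le_sum[of k UNIV "\<lambda>i. \<Sum>j\<in>UNIV. \<bar>A $ i $ j\<bar>"]) (auto intro: sum_nonneg)
  finally show ?thesis .
qed

text \<open>A real eigenvector, embedded entrywise, is a complex one. The supremum dominates its
  eigenvalue because the set of moduli is bounded.\<close>

lemma abs_real_eigenvalue_le_spectral_radius:
  fixes A :: "real^'n^'n"
  assumes v: "v \<noteq> 0" and ev: "A *v v = l *\<^sub>R v"
  shows "\<bar>l\<bar> \<le> spectral_radius A"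
proof -
  let ?v = "\<chi> i. complex_of_real (v $ i)"
  have "(\<Sum>j\<in>UNIV. A $ i $ j * v $ j) = l * v $ i" for i
    using arg_cong[OF ev, of "\<lambda>w. w $ i"] by (simp add: matrix_vector_mult_def)
  then have "(\<chi> i j. complex_of_real (A $ i $ j)) *v ?v = complex_of_real l *s ?v"
    by (simp add: vec_eq_iff matrix_vector_mult_def flip: of_real_mult of_real_sum)
  moreover have "?v \<noteq> 0" using v by (simp add: vec_eq_iff)
  ultimately have "complex_of_real l \<in> complex_eigenvalues A"
    by (auto simp: complex_eigenvalues_def)
  moreover have "bdd_above (cmod ` complex_eigenvalues A)"
    using complex_eigenvalues_bounded by (fastforce intro: bdd_aboveI)
  ultimately show ?thesis
    unfolding spectral_radius_def by (metis cSUP_upper norm_of_real)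
qed

text \<open>Compactness gives a unit vector u at which norm (B u) attains its maximum M. Equality in
  Cauchy-Schwarz for B (B u) and u forces B (B u) = M^2 u, and factoring B^2 - M^2 yields an
  eigenvector for M or -M.\<close>

lemma symmetric_matrix_norm_attained_at_eigenvalue:
  fixes B :: "real^'n^'n"
  assumes sym: "transpose B = B"
  obtains l u where "u \<noteq> 0" "B *v u = l *\<^sub>R u" "\<And>z. norm (B *v z) \<le> \<bar>l\<bar> * norm z"
proof -
  have selfadj: "(B *v a) \<bullet> b = a \<bullet> (B *v b)" for a b
    by (metis sym dot_lmul_matrix transpose_matrix_vector)
  have "continuous_on (sphere 0 1) (\<lambda>z. norm (B *v z))"
    by (intro continuous_intros)
  moreover have "axis k (1::real) \<in> sphere (0::real^'n) 1" for k by simp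
  ultimately obtain u where u: "u \<in> sphere 0 1"
    and umax: "\<And>z. z \<in> sphere 0 1 \<Longrightarrow> norm (B *v z) \<le> norm (B *v u)"
    by (metis continuous_attains_sup compact_sphere empty_iff)
  define M where "M = norm (B *v u)"
  have nu: "norm u = 1" using u by simp
  have M0: "0 \<le> M" by (simp add: M_def)
  have bound: "norm (B *v z) \<le> M * norm z" for z
  proof (cases "z = 0")
    case False
    have "norm (B *v (z /\<^sub>R norm z)) \<le> M"
      unfolding M_def using False by (intro umax) simp
    then show ?thesis
      using False by (simp add: matrix_vector_mult_scaleR field_simps)
  qed simp
  let ?w = "B *v (B *v u)"
  have "(norm ?w)\<^sup>2 \<le> (M * M)\<^sup>2"
    using bound[of "B *v u"] by (intro power_mono) (simp_all add: M_def)
  moreover have "(norm (?w - (M * M) *\<^sub>R u))\<^sup>2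
      = (norm ?w)\<^sup>2 - 2 * (M * M) * (?w \<bullet> u) + (M * M)\<^sup>2 * (norm u)\<^sup>2"
    unfolding power2_norm_eq_inner
    by (simp add: inner_diff inner_commute[of u ?w] algebra_simps power2_eq_square)
  moreover have "?w \<bullet> u = M * M"
    by (simp add: selfadj[of "B *v u" u] M_def flip: power2_norm_eq_inner power2_eq_square)
  ultimately have "(norm (?w - (M * M) *\<^sub>R u))\<^sup>2 \<le> 0"
    by (simp add: nu power2_eq_square)
  then have w: "?w = (M * M) *\<^sub>R u" by simp
  \<comment> \<open>Hence \<open>(B - M) (B + M) u = 0\<close>, so \<open>-M\<close> or \<open>M\<close> is an eigenvalue.\<close>
  show ?thesis
  proof (cases "B *v u + M *\<^sub>R u = 0")
    case True
    show ?thesis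
    proof (rule that[of u "- M"])
      show "u \<noteq> 0" using nu by auto
      show "B *v u = (- M) *\<^sub>R u" using True by (simp add: eq_neg_iff_add_eq_0)
    qed (use bound M0 in simp)
  next
    case False
    show ?thesis
    proof (rule that[of "B *v u + M *\<^sub>R u" M])
      show "B *v (B *v u + M *\<^sub>R u) = M *\<^sub>R (B *v u + M *\<^sub>R u)"
        by (simp add: matrix_vector_right_distrib matrix_vector_mult_scaleR w algebra_simps)
    qed (use False bound M0 in simp_all)
  qed
qed

text \<open>Each term h a b is at most |h| (a^2 + b^2) / 2. Symmetry makes the a-halves and the
  b-halves add up to the same weighted row sums.\<close>

lemma symmetric_quadratic_form_le_abs_row_sums:
  fixes H :: "real^'n^'n"
  assumes sym: "transpose H = H"
  shows "z \<bullet> (H *v z) \<le> z \<bullet> (diagonal_matrix (\<lambda>i. \<Sum>j\<in>UNIV. \<bar>H $ i $ j\<bar>) *v z)"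
proof -
  have symij: "H $ j $ i = H $ i $ j" for i j
    using sym by (metis transpose_def vec_lambda_beta)
  have am_gm: "h * (a * b) \<le> \<bar>h\<bar> * (a\<^sup>2 / 2) + \<bar>h\<bar> * (b\<^sup>2 / 2)" for h a b :: real
  proof -
    have "\<bar>a * b\<bar> \<le> a\<^sup>2 / 2 + b\<^sup>2 / 2"
      using sum_squares_bound[of a b] sum_squares_bound[of a "- b"] by (auto simp: abs_if)
    then have "\<bar>h\<bar> * \<bar>a * b\<bar> \<le> \<bar>h\<bar> * (a\<^sup>2 / 2 + b\<^sup>2 / 2)"
      by (rule mult_left_mono) simp
    moreover have "h * (a * b) \<le> \<bar>h\<bar> * \<bar>a * b\<bar>"
      by (metis abs_ge_self abs_mult)
    ultimately show ?thesis by (simp add: distrib_left)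
  qed
  have "z \<bullet> (H *v z) = (\<Sum>i\<in>UNIV. \<Sum>j\<in>UNIV. H $ i $ j * (z $ i * z $ j))"
    by (simp add: inner_vec_def matrix_vector_mult_def sum_distrib_left mult.left_commute)
  also have "\<dots> \<le> (\<Sum>i\<in>UNIV. \<Sum>j\<in>UNIV.
      \<bar>H $ i $ j\<bar> * ((z $ i)\<^sup>2 / 2) + \<bar>H $ i $ j\<bar> * ((z $ j)\<^sup>2 / 2))"
    by (intro sum_mono am_gm)
  also have "\<dots> = (\<Sum>i\<in>UNIV. \<Sum>j\<in>UNIV. \<bar>H $ i $ j\<bar> * ((z $ i)\<^sup>2 / 2))
      + (\<Sum>j\<in>UNIV. \<Sum>i\<in>UNIV. \<bar>H $ i $ j\<bar> * ((z $ j)\<^sup>2 / 2))"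
    by (subst (3) sum.swap) (simp add: sum.distrib)
  also have "\<dots> = 2 * (\<Sum>i\<in>UNIV. \<Sum>j\<in>UNIV. \<bar>H $ i $ j\<bar> * ((z $ i)\<^sup>2 / 2))"
    by (simp add: symij)
  also have "\<dots> = z \<bullet> (diagonal_matrix (\<lambda>i. \<Sum>j\<in>UNIV. \<bar>H $ i $ j\<bar>) *v z)"
    by (simp add: inner_vec_def diagonal_matrix_vector sum_distrib_left sum_distrib_right
        power2_eq_square mult_ac)
  finally show ?thesis .
qed

lemma positive_definite_diagonal_pos:
  fixes H :: "real^'n^'n"
  assumes "positive_definite H"
  shows "0 < H $ i $ i"
proof -
  have "0 < axis i 1 \<bullet> (H *v axis i 1)"
    using assms by (simp add: positive_definite_def)
  then show ?thesis
    by (simp add: inner_axis' matrix_vector_mul_component inner_axis)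
qed

lemma P_sym_eq_abs_row_sums:
  assumes V: "verts G = UNIV" and sym: "transpose H = H" and width: "has_geodesic_width G H w"
  shows "P_sym G w H = diagonal_matrix (\<lambda>i. \<Sum>j\<in>UNIV. \<bar>H $ i $ j\<bar>)"
proof -
  have "H $ i $ j = 0" if "j \<notin> hop_ball G i w" for i j
  proof -
    \<comment> \<open>\<open>hop_ball\<close> measures the distance from j to i, so the width
      condition speaks about the entry (j, i); symmetry carries it over to (i, j).\<close>
    have "H $ j $ i = 0"
      using that V width by (auto simp: hop_ball_def has_geodesic_width_def)
    then show ?thesis using sym by (metis transpose_def vec_lambda_beta)
  qed
  then have "(\<Sum>j\<in>hop_ball G i w. \<bar>H $ i $ j\<bar>) = (\<Sum>j\<in>UNIV. \<bar>H $ i $ j\<bar>)" for i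
    by (intro sum.mono_neutral_left) auto
  then show ?thesis by (simp add: P_sym_def)
qed

theorem mainTheorem3:
  fixes G :: "('v::finite, 'e) pre_digraph"
    and H :: "real^'v^'v"
    and \<omega> :: nat
    and y :: "real^'v"
    and x :: "nat \<Rightarrow> real^'v"
  assumes "graph G" and "Digraph_Component.connected G" and "verts G = UNIV"
    and "positive_definite H"
    and "has_geodesic_width G H \<omega>"
    and "\<And>m. m \<ge> 1 \<Longrightarrow>
           x m = x (m - 1) - matrix_inv (P_sym G \<omega> H) *v (H *v x (m - 1) - y)"
  shows "converges_exponentially x (matrix_inv H *v y) \<and>
    (\<forall>m. norm (mat_sqrt (P_sym G \<omega> H) *v (x m - matrix_inv H *v y))
       \<le> spectral_radius (mat 1 - matrix_inv (P_sym G \<omega> H) ** H) ^ m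
         * norm (mat_sqrt (P_sym G \<omega> H) *v (x 0 - matrix_inv H *v y)))"
proof -
  define d where "d = (\<lambda>i. \<Sum>j\<in>UNIV. \<bar>H $ i $ j\<bar>)"
  define P where "P = P_sym G \<omega> H"
  define S where "S = diagonal_matrix (\<lambda>i. sqrt (d i))"
  define E where "E = diagonal_matrix (\<lambda>i. 1 / sqrt (d i))"
  define A where "A = mat 1 - matrix_inv P ** H"
  define B where "B = mat 1 - E ** H ** E"
  define s where "s = matrix_inv H *v y"
  define z where "z = (\<lambda>m. S *v (x m - s))"
  have sym: "transpose H = H"
    and pd: "\<And>x. x \<noteq> 0 \<Longrightarrow> 0 < x \<bullet> (H *v x)"
    using assms(4) by (simp_all add: positive_definite_def)
  \<comment> \<open>The positive diagonal entry of H is one summand of the row sum, so the square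
    roots and reciprocals below are genuine.\<close>
  have dpos: "0 < d i" for i
    using positive_definite_diagonal_pos[OF assms(4), of i]
      member_le_sum[of i UNIV "\<lambda>j. \<bar>H $ i $ j\<bar>"] by (simp add: d_def)
  have P: "P = diagonal_matrix d"
    unfolding P_def d_def by (rule P_sym_eq_abs_row_sums[OF assms(3) sym assms(5)])
  have sqrtP: "mat_sqrt P = S"
    unfolding P S_def by (rule mat_sqrt_diagonal_matrix) (rule dpos)
  have SE: "S ** E = mat 1" and ES: "E ** S = mat 1" and SS: "S ** S = P"
    unfolding S_def E_def P diagonal_matrix_mult_left
    using dpos by (auto simp: diagonal_matrix_def mat_def vec_eq_iff less_imp_le
        less_imp_neq[symmetric])
  have Eself: "(E *v a) \<bullet> b = a \<bullet> (E *v b)" for a b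
    by (simp add: E_def diagonal_matrix_vector inner_vec_def)
  have Esym: "transpose E = E"
    by (auto simp: E_def transpose_def diagonal_matrix_def vec_eq_iff)
  have Pinv: "matrix_inv P = E ** E"
  proof -
    have inv: "P ** (E ** E) = mat 1" "(E ** E) ** P = mat 1"
      unfolding SS[symmetric] by (metis SE ES matrix_mul_assoc matrix_mul_rid)+
    then show ?thesis by (rule matrix_inv_unique)
  qed
  \<comment> \<open>This is the similarity: the invertible E carries eigenvectors of B to
    eigenvectors of A with the same eigenvalue.\<close>
  have EB: "E *v (B *v v) = A *v (E *v v)" for v
    by (simp add: A_def B_def Pinv matrix_vector_mult_diff_rdistrib matrix_vector_mult_diff_distrib
        flip: matrix_vector_mul_assoc)
  have E_S: "E *v (S *v v) = v" and S_E: "S *v (E *v v) = v" for v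
    by (simp_all add: matrix_vector_mul_assoc ES SE)
  have Bsym: "transpose B = B"
  proof -
    have "transpose (mat 1 - X) = mat 1 - transpose X" for X :: "real^'v^'v"
      by (auto simp: transpose_def mat_def vec_eq_iff)
    then show ?thesis
      by (simp add: B_def matrix_transpose_mul Esym sym matrix_mul_assoc)
  qed
  obtain l u where u: "u \<noteq> 0" and Bu: "B *v u = l *\<^sub>R u"
    and Bbound: "\<And>z. norm (B *v z) \<le> \<bar>l\<bar> * norm z"
    using symmetric_matrix_norm_attained_at_eigenvalue[OF Bsym] by blast
  have Eu: "E *v u \<noteq> 0" using u S_E[of u] by (metis matrix_vector_mult_0_right)
  have "A *v (E *v u) = l *\<^sub>R (E *v u)"
    by (simp add: Bu matrix_vector_mult_scaleR flip: EB)
  with Eu have l_le: "\<bar>l\<bar> \<le> spectral_radius A"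
    by (rule abs_real_eigenvalue_le_spectral_radius)
  \<comment> \<open>Testing the eigenvalue equation with u turns (1 - l) (u . u) into the quadratic
    form of H at E u. The row-sum bound gives 1 - l \<le> 1, and positive definiteness gives 1 - l >
    0.\<close>
  have "0 \<le> l \<and> l < 1"
  proof -
    have uu: "0 < u \<bullet> u" using u by simp
    have "u \<bullet> (B *v u) = u \<bullet> u - (E *v u) \<bullet> (H *v (E *v u))"
      by (simp add: B_def matrix_vector_mult_diff_rdistrib inner_diff_right Eself
          flip: matrix_vector_mul_assoc)
    then have form: "(E *v u) \<bullet> (H *v (E *v u)) = (1 - l) * (u \<bullet> u)"
      by (simp add: Bu algebra_simps)
    have "(E *v u) \<bullet> (H *v (E *v u)) \<le> (E *v u) \<bullet> (P *v (E *v u))"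
      unfolding P d_def by (rule symmetric_quadratic_form_le_abs_row_sums[OF sym])
    also have "\<dots> = u \<bullet> u"
      by (simp add: Eself E_S S_E flip: SS matrix_vector_mul_assoc)
    finally have "(1 - l) * (u \<bullet> u) \<le> 1 * (u \<bullet> u)" by (simp add: form)
    then have "1 - l \<le> 1" using uu by (meson mult_le_cancel_right not_less_iff_gr_or_eq)
    moreover have "0 < (1 - l) * (u \<bullet> u)" using pd[OF Eu] by (simp add: form)
    then have "0 < 1 - l" using uu by (simp add: zero_less_mult_iff)
    ultimately show ?thesis by simp
  qed
  then have l: "0 \<le> l" "l < 1" by auto
  obtain H' where "H ** H' = mat 1" "H' ** H = mat 1"
    using positive_definite_invertible[OF assms(4)] unfolding invertible_def by blast
  \<comment> \<open>So s is a fixed point of the iteration, and the error x m - s obeys the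
    homogeneous recursion with matrix A.\<close>
  then have Hs: "H *v s = y"
    by (simp add: s_def matrix_vector_mul_assoc matrix_inv_unique[of H H'])
  have z_Suc: "z (Suc m) = B *v z m" for m
  proof -
    have "x (Suc m) - s = (x m - s) - matrix_inv P *v (H *v (x m - s))"
      using assms(6)[of "Suc m"] by (simp add: P_def Hs matrix_vector_mult_diff_distrib)
    also have "\<dots> = A *v (E *v z m)"
      by (simp add: A_def z_def E_S matrix_vector_mult_diff_rdistrib flip: matrix_vector_mul_assoc)
    also have "\<dots> = E *v (B *v z m)" by (simp add: EB)
    finally show ?thesis by (simp add: z_def S_E)
  qed
  have zl: "norm (z m) \<le> l ^ m * norm (z 0)" for m
  proof (induction m)
    case (Suc m)
    have "norm (z (Suc m)) \<le> l * norm (z m)"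
      using Bbound[of "z m"] l by (simp add: z_Suc)
    also have "\<dots> \<le> l * (l ^ m * norm (z 0))"
      using Suc l by (intro mult_left_mono) auto
    finally show ?case by simp
  qed simp
  have "converges_exponentially x s"
  proof -
    obtain K where K: "\<And>v. norm (E *v v) \<le> norm v * K" and K0: "0 < K"
      using bounded_linear.pos_bounded[OF matrix_vector_mul_bounded_linear[of E]] by blast
    \<comment> \<open>The factor K undoes the rescaling, as x m - s = E (z m). The summand 1 keeps
      the constant positive even if z 0 = 0.\<close>
    have "norm (x m - s) \<le> (norm (z 0) * K + 1) * l ^ m" for m
    proof -
      have "norm (x m - s) \<le> norm (z m) * K"
        using K[of "z m"] by (simp add: z_def E_S)
      also have "\<dots> \<le> l ^ m * norm (z 0) * K"
        using K0 zl by (intro mult_right_mono) auto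
      also have "\<dots> \<le> (norm (z 0) * K + 1) * l ^ m"
        using l by (simp add: algebra_simps)
      finally show ?thesis .
    qed
    moreover have "0 < norm (z 0) * K + 1"
      using K0 by (simp add: add_nonneg_pos)
    ultimately show ?thesis
      unfolding converges_exponentially_def using l by blast
  qed
  moreover have "norm (z m) \<le> spectral_radius A ^ m * norm (z 0)" for m
  proof -
    \<comment> \<open>Nonnegativity of l lets \<open>l_le\<close> be raised to the power m.\<close>
    have "l ^ m \<le> spectral_radius A ^ m"
      using l l_le by (intro power_mono) auto
    then show ?thesis
      using zl[of m] by (meson mult_right_mono norm_ge_zero order_trans)
  qed
  ultimately show ?thesis
    unfolding P_def[symmetric] sqrtP s_def[symmetric] A_def[symmetric] z_def by blast
qed

end
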